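(* Let $(Q,\mathscr{K})$ be a non-trivial knowledge space. Then $(Q,\mathscr{K})$ is complementary; that is, there exists a non-discrete knowledge space $(Q,\mathscr{L})$ on the same set $Q$ such that (i) for each $q\in Q$ there are finitely many $K_1,\dots,K_n\in\mathscr{K}$ and $L_1,\dots,L_m\in\mathscr{L}$ with $\left(\bigcap_{i=1}^{n}K_i\right)\cap\left(\bigcap_{j=1}^{m}L_j\right)=\{q\}$; and (ii) $\mathscr{K}\cap\mathscr{L}=\{\emptyset,Q\}$.
   Context: Let $Q$ be a non-empty set (possibly infinite). A knowledge structure on $Q$ is a pair $(Q,\mathscr{H})$ where $\mathscr{H}$ is a family of subsets of $Q$ with $\{\emptyset,Q\}\subseteq\mathscr{H}$. A knowledge space is a knowledge structure $(Q,\mathscr{K})$ such that $\mathscr{K}$ is closed under (arbitrary) unions. A knowledge space $(Q,\mathscr{K})$ is discrete if for each $q\in Q$ there exist finitely many $K_1,\dots,K_n\in\mathscr{K}$ with $\{q\}=\bigcap_{i=1}^{n}K_i$. It is non-trivial if it is non-discrete and $\mathscr{K}\neq\{\emptyset,Q\}$. A knowledge space $(Q,\mathscr{K})$ is complementary if there exists a non-discrete knowledge space $(Q,\mathscr{L})$ satisfying conditions (i) and (ii) of the claim. *)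

theory Defs
  imports Main
begin

text \<open>The underlying set \<open>Q\<close> is an arbitrary non-empty set over an arbitrary type; a knowledge
  structure or space is given by \<open>Q\<close> together with a family of subsets of \<open>Q\<close>.\<close>

definition knowledge_structure :: "'a set \<Rightarrow> 'a set set \<Rightarrow> bool" where
  "knowledge_structure Q H \<longleftrightarrow> Q \<noteq> {} \<and> H \<subseteq> Pow Q \<and> {{}, Q} \<subseteq> H"

definition knowledge_space :: "'a set \<Rightarrow> 'a set set \<Rightarrow> bool" where
  "knowledge_space Q K \<longleftrightarrow> knowledge_structure Q K \<and> (\<forall>F. F \<subseteq> K \<longrightarrow> \<Union>F \<in> K)"

text \<open>A list \<open>K\<^sub>1, \<dots>, K\<^sub>n\<close> is represented by the finite set \<open>F\<close> of its members. Requiring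
  \<open>F \<noteq> {}\<close> means \<open>n \<ge> 1\<close>, so that the convention \<open>\<Inter>{} = UNIV\<close> plays no role; since \<open>Q\<close> itself
  belongs to the family, reading the empty intersection as \<open>Q\<close> would give the same notions.\<close>

definition discrete_space :: "'a set \<Rightarrow> 'a set set \<Rightarrow> bool" where
  "discrete_space Q K \<longleftrightarrow>
     (\<forall>q\<in>Q. \<exists>F. finite F \<and> F \<noteq> {} \<and> F \<subseteq> K \<and> {q} = \<Inter>F)"

definition nontrivial_space :: "'a set \<Rightarrow> 'a set set \<Rightarrow> bool" where
  "nontrivial_space Q K \<longleftrightarrow> \<not> discrete_space Q K \<and> K \<noteq> {{}, Q}"

definition complementary :: "'a set \<Rightarrow> 'a set set \<Rightarrow> bool" where
  "complementary Q K \<longleftrightarrow>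
     (\<exists>L. knowledge_space Q L \<and> \<not> discrete_space Q L \<and>
        (\<forall>q\<in>Q. \<exists>F G. finite F \<and> F \<noteq> {} \<and> F \<subseteq> K \<and> finite G \<and> G \<noteq> {} \<and> G \<subseteq> L \<and>
            \<Inter>F \<inter> \<Inter>G = {q}) \<and>
        K \<inter> L = {{}, Q})"

end

theory Submission imports Defs begin

text \<open>The finite intersections of members of \<open>K\<close> generate a topology \<open>\<tau>\<close>, and we show that every
  topology has a complement in the lattice of topologies on \<open>Q\<close>. Fix a well-order of the points.
  A set \<open>E\<close> is a \<^emph>\<open>thread\<close> in an open set \<open>W\<close> if no point of \<open>E\<close> is a limit of its predecessors in
  \<open>E\<close>, whereas every final segment of \<open>E\<close> is dense in \<open>W\<close>. Declaring the initial segments of \<open>E\<close> open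
  then isolates each point relative to \<open>\<tau>\<close>, and no proper non-empty initial segment is open in
  \<open>\<tau>\<close>, as its complement is dense. A set that is dense somewhere contains a thread, so a
  maximal disjoint family of threads covers a non-empty open subset of any given open set, and this
  subset has a complement. Finally, a maximal disjoint family of complemented open sets has a dense
  union. The complements are glued by making the points chosen one from each of these sets
  indistinguishable; the points outside the union become isolated, and every open set of the
  complement that meets the union contains all of them.\<close>

text \<open>Zorn's lemma, since the union of a chain of disjoint families is again disjoint.
  Maximality is used in this form: a non-empty member of \<open>S\<close> that misses
  \<open>\<Union>M\<close> gives a contradiction.\<close>

lemma maximal_disjoint_subfamily:
  fixes S :: "'a set set"
  obtains M where "M \<subseteq> S" "pairwise disjnt M" "\<forall>X\<in>S. (\<forall>Y\<in>M. disjnt X Y) \<longrightarrow> X \<in> M"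
proof -
  define \<P> where "\<P> = {M. M \<subseteq> S \<and> pairwise disjnt M}"
  have "\<exists>M\<in>\<P>. \<forall>X\<in>\<P>. M \<subseteq> X \<longrightarrow> X = M"
  proof (rule subset_Zorn')
    fix C assume chain: "subset.chain \<P> C"
    then have C: "M \<subseteq> S" "pairwise disjnt M" if "M \<in> C" for M
      using that by (auto simp: subset_chain_def \<P>_def)
    have "chain\<^sub>\<subseteq> C"
      using chain unfolding subset_chain_def chain_subset_def by (rule conjunct2)
    with C(2) have "pairwise disjnt (\<Union>C)"
      by (rule pairwise_chain_Union)
    moreover have "\<Union>C \<subseteq> S" using C(1) by (rule Union_least)
    ultimately show "\<Union>C \<in> \<P>" by (simp add: \<P>_def)
  qed
  then obtain M where M: "M \<in> \<P>" and max: "\<And>X. X \<in> \<P> \<Longrightarrow> M \<subseteq> X \<Longrightarrow> X = M" by metis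
  have "X \<in> M" if X: "X \<in> S" "\<forall>Y\<in>M. disjnt X Y" for X
  proof -
    have "insert X M \<in> \<P>"
      using M X by (simp add: \<P>_def pairwise_insert disjnt_sym)
    then show ?thesis using max[of "insert X M"] by blast
  qed
  with M show thesis by (intro that[of M]) (simp_all add: \<P>_def)
qed

section \<open>Density and a well-order of the points\<close>

locale well_ordered_base =
  fixes Q :: "'a set" and \<tau> :: "'a set set" and r :: "'a rel"
  assumes open_subset: "A \<in> \<tau> \<Longrightarrow> A \<subseteq> Q"
    and open_Int: "A \<in> \<tau> \<Longrightarrow> B \<in> \<tau> \<Longrightarrow> A \<inter> B \<in> \<tau>"
    and open_space: "Q \<in> \<tau>"
    and wo: "well_order_on UNIV r"
begin

lemma order_refl: "(x, x) \<in> r"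
  and order_trans: "(x, y) \<in> r \<Longrightarrow> (y, z) \<in> r \<Longrightarrow> (x, z) \<in> r"
  and order_antisym: "(x, y) \<in> r \<Longrightarrow> (y, x) \<in> r \<Longrightarrow> x = y"
  and order_total: "(x, y) \<in> r \<or> (y, x) \<in> r"
proof -
  have r: "refl r" "trans r" "antisym r" "total r" using wo by (simp_all add: order_on_defs)
  show "(x, x) \<in> r" using r(1) by (rule reflD)
  show "(x, y) \<in> r \<Longrightarrow> (y, z) \<in> r \<Longrightarrow> (x, z) \<in> r" using r(2) by (rule transD)
  show "(x, y) \<in> r \<Longrightarrow> (y, x) \<in> r \<Longrightarrow> x = y" using r(3) by (rule antisymD)
  show "(x, y) \<in> r \<or> (y, x) \<in> r"
    using r(4) reflD[OF r(1), of x] by (cases "x = y") (auto simp: total_on_def)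
qed

lemma least_element:
  assumes "S \<noteq> {}"
  obtains d where "d \<in> S" "\<And>x. x \<in> S \<Longrightarrow> (d, x) \<in> r"
proof -
  have "wf (r - Id)" using wo by (simp add: well_order_on_def)
  then obtain d where "d \<in> S" "\<And>x. (x, d) \<in> r - Id \<Longrightarrow> x \<notin> S"
    using assms by (metis ex_in_conv wfE_min)
  then show thesis using that order_total by blast
qed

text \<open>Only open sets inside \<open>W\<close> are tested, so density passes to every smaller
  \<open>W\<close>.\<close>

definition dense_in :: "'a set \<Rightarrow> 'a set \<Rightarrow> bool" where
  "dense_in R W \<longleftrightarrow> (\<forall>V\<in>\<tau>. V \<noteq> {} \<longrightarrow> V \<subseteq> W \<longrightarrow> V \<inter> R \<noteq> {})"

lemma dense_inD: "dense_in R W \<Longrightarrow> V \<in> \<tau> \<Longrightarrow> V \<noteq> {} \<Longrightarrow> V \<subseteq> W \<Longrightarrow> V \<inter> R \<noteq> {}"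
  unfolding dense_in_def by blast

section \<open>Threads\<close>

definition below :: "'a \<Rightarrow> 'a set" where
  "below e = {x. (x, e) \<in> r \<and> x \<noteq> e}"

definition thread :: "'a set \<Rightarrow> 'a set \<Rightarrow> bool" where
  "thread E W \<longleftrightarrow> E \<noteq> {} \<and> E \<subseteq> W \<and> W \<in> \<tau> \<and>
     (\<forall>e\<in>E. \<exists>B\<in>\<tau>. e \<in> B \<and> B \<inter> E \<inter> below e = {}) \<and>
     (\<forall>e\<in>E. dense_in (E - below e) W)"

text \<open>The thread is cut out of an initial segment of \<open>R\<close> that is dense in some open set
  and as short as possible, so that the shorter initial segments are dense nowhere.\<close>

lemma thread_in_dense_set:
  assumes O: "O1 \<in> \<tau>" "O1 \<noteq> {}" and R: "dense_in R O1"
  obtains E W where "thread E W" "E \<subseteq> R" "W \<subseteq> O1"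
proof -
  define N where "N b \<longleftrightarrow> (\<exists>W\<in>\<tau>. W \<noteq> {} \<and> W \<subseteq> O1 \<and> dense_in (R \<inter> below b) W)" for b
  have "\<exists>W D. W \<in> \<tau> \<and> W \<noteq> {} \<and> W \<subseteq> O1 \<and> D \<subseteq> R \<inter> W \<and> dense_in D W \<and> (\<forall>e\<in>D. \<not> N e)"
  proof (cases "\<exists>b. N b")
    case True
    then obtain b where b: "N b" "\<And>c. N c \<Longrightarrow> (b, c) \<in> r"
      using least_element[of "{b. N b}"] by auto
    then obtain W where "W \<in> \<tau>" "W \<noteq> {}" "W \<subseteq> O1" "dense_in (R \<inter> below b) W"
      by (auto simp: N_def)
    moreover from this have "dense_in (R \<inter> below b \<inter> W) W"
      unfolding dense_in_def by blast
    moreover have "\<not> N e" if "e \<in> below b" for e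
      using that b(2) order_antisym by (auto simp: below_def)
    ultimately show ?thesis by (intro exI[of _ W] exI[of _ "R \<inter> below b \<inter> W"]) auto
  next
    case False
    moreover have "dense_in (R \<inter> O1) O1" using R unfolding dense_in_def by blast
    ultimately show ?thesis using O by (intro exI[of _ O1] exI[of _ "R \<inter> O1"]) auto
  qed
  then obtain W D where W: "W \<in> \<tau>" "W \<noteq> {}" "W \<subseteq> O1" and D: "D \<subseteq> R \<inter> W" "dense_in D W"
    and N: "\<And>e. e \<in> D \<Longrightarrow> \<not> N e" by blast
  \<comment> \<open>Dropping the points that are limits of their predecessors in \<open>D\<close>
    preserves density: the least point of \<open>D\<close> in any non-empty open
    \<open>V \<subseteq> W\<close> is kept.\<close>
  define E where "E = {e \<in> D. \<exists>B\<in>\<tau>. e \<in> B \<and> B \<inter> D \<inter> below e = {}}"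
  have first: "\<exists>d\<in>E. d \<in> V" if V: "V \<in> \<tau>" "V \<noteq> {}" "V \<subseteq> W" for V
  proof -
    have "V \<inter> D \<noteq> {}" using dense_inD[OF D(2) V] .
    then obtain d where d: "d \<in> V \<inter> D" "\<And>x. x \<in> V \<inter> D \<Longrightarrow> (d, x) \<in> r"
      using least_element[of "V \<inter> D"] by metis
    then have "V \<inter> D \<inter> below d = {}" using order_antisym by (auto simp: below_def)
    with d(1) V(1) show ?thesis unfolding E_def by blast
  qed
  have "dense_in (E - below e) W" if "e \<in> E" for e
    unfolding dense_in_def
  proof (intro ballI impI)
    fix V assume V: "V \<in> \<tau>" "V \<noteq> {}" "V \<subseteq> W"
    \<comment> \<open>As \<open>e\<close> fails \<open>N\<close>, some non-empty open
      \<open>V' \<subseteq> V\<close> avoids all points of \<open>R\<close> before \<open>e\<close>;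
      the points of \<open>E\<close> in \<open>V'\<close> therefore lie in the final segment from
      \<open>e\<close>.\<close>
    have "\<not> dense_in (R \<inter> below e) V"
      using N[of e] that V W unfolding N_def E_def by blast
    then obtain V' where V': "V' \<in> \<tau>" "V' \<noteq> {}" "V' \<subseteq> V" "V' \<inter> (R \<inter> below e) = {}"
      by (auto simp: dense_in_def)
    with V(3) first[of V'] obtain d where "d \<in> E" "d \<in> V'" by blast
    with V' D(1) show "V \<inter> (E - below e) \<noteq> {}" unfolding E_def by blast
  qed
  moreover have "E \<noteq> {}" "E \<subseteq> W" using first[OF W(1,2)] D(1) by (auto simp: E_def)
  moreover have "\<exists>B\<in>\<tau>. e \<in> B \<and> B \<inter> E \<inter> below e = {}" if "e \<in> E" for e
    using that unfolding E_def by blast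
  ultimately have "thread E W" using W(1) by (simp add: thread_def)
  moreover have "E \<subseteq> R" using D(1) by (auto simp: E_def)
  ultimately show thesis using W(3) by (rule that)
qed

section \<open>Complements on open sets\<close>

text \<open>\<open>L\<close> is a topology on \<open>U\<close>, with \<open>{} \<in> L\<close> as
  the case \<open>F = {}\<close>. For open \<open>U\<close> the last two clauses make it a lattice
  complement of the trace of \<open>\<tau>\<close>: the join is discrete, the meet trivial.\<close>

definition complement :: "'a set \<Rightarrow> 'a set set \<Rightarrow> bool" where
  "complement U L \<longleftrightarrow> L \<subseteq> Pow U \<and> U \<in> L \<and> (\<forall>F \<subseteq> L. \<Union>F \<in> L) \<and> (\<forall>A\<in>L. \<forall>B\<in>L. A \<inter> B \<in> L) \<and>
     (\<forall>v\<in>U. \<exists>A\<in>L. \<exists>B\<in>\<tau>. A \<inter> B = {v}) \<and> (\<forall>A\<in>L. A \<in> \<tau> \<longrightarrow> A = {} \<or> A = U)"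

lemma complementD:
  assumes "complement U L"
  shows "A \<in> L \<Longrightarrow> A \<subseteq> U"
    and "U \<in> L"
    and "{} \<in> L"
    and "F \<subseteq> L \<Longrightarrow> \<Union>F \<in> L"
    and "A \<in> L \<Longrightarrow> B \<in> L \<Longrightarrow> A \<inter> B \<in> L"
    and "v \<in> U \<Longrightarrow> \<exists>A\<in>L. \<exists>B\<in>\<tau>. A \<inter> B = {v}"
    and "A \<in> L \<Longrightarrow> A \<in> \<tau> \<Longrightarrow> A = {} \<or> A = U"
proof -
  show "{} \<in> L" using assms unfolding complement_def by (metis Union_empty empty_subsetI)
qed (use assms in \<open>auto simp: complement_def\<close>)

lemma complemented_open_subset:
  assumes O: "O1 \<in> \<tau>" "O1 \<noteq> {}"
  obtains U where "U \<in> \<tau>" "U \<noteq> {}" "U \<subseteq> O1" "\<exists>L. complement U L"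
proof -
  obtain M where M: "M \<subseteq> {E. \<exists>W\<subseteq>O1. thread E W}" and disj: "pairwise disjnt M"
    and max: "\<forall>X\<in>{E. \<exists>W\<subseteq>O1. thread E W}. (\<forall>Y\<in>M. disjnt X Y) \<longrightarrow> X \<in> M"
    by (rule maximal_disjoint_subfamily)
  define R where "R = O1 - \<Union>M"
  \<comment> \<open>A thread inside \<open>R\<close> would be disjoint from all of \<open>M\<close>
    and hence belong to \<open>M\<close> by maximality.\<close>
  have nowhere: "\<not> dense_in R V" if V: "V \<in> \<tau>" "V \<noteq> {}" "V \<subseteq> O1" for V
  proof
    assume "dense_in R V"
    then obtain E W where E: "thread E W" "E \<subseteq> R" "W \<subseteq> V"
      using thread_in_dense_set V by metis
    have "E \<in> M" using E V(3) by (intro max[rule_format]) (auto simp: R_def disjnt_def)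
    with E(1,2) show False by (auto simp: R_def thread_def)
  qed
  have "M \<noteq> {}"
    using nowhere[OF O] by (auto simp: R_def dense_in_def)
  then obtain E0 W0 where E0: "E0 \<in> M" "thread E0 W0" "W0 \<subseteq> O1" using M by blast
  have W0: "W0 \<in> \<tau>" "W0 \<noteq> {}" using E0(2) by (auto simp: thread_def)
  \<comment> \<open>\<open>U\<close> is taken inside \<open>W0\<close> so that the final segments of
    the single thread \<open>E0\<close> are dense in it; missing \<open>R\<close> means that
    \<open>M\<close> covers \<open>U\<close>.\<close>
  from nowhere[OF W0 E0(3)] obtain U
    where U: "U \<in> \<tau>" "U \<noteq> {}" "U \<subseteq> W0" "U \<inter> R = {}" by (auto simp: dense_in_def)
  have cover: "\<exists>E\<in>M. v \<in> E" if "v \<in> U" for v using that U E0(3) by (auto simp: R_def)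
  define L where "L = {A. A \<subseteq> U \<and> (\<forall>E\<in>M. \<forall>x \<in> E \<inter> U. \<forall>y \<in> E \<inter> A. (x, y) \<in> r \<longrightarrow> x \<in> A)}"
  have initial: "x \<in> A" if "A \<in> L" "E \<in> M" "x \<in> E \<inter> U" "y \<in> E \<inter> A" "(x, y) \<in> r" for A E x y
    using that unfolding L_def by blast
  \<comment> \<open>Being initial on \<open>E\<close>, \<open>A\<close> misses the final segment of
    \<open>E\<close> from \<open>v\<close>, which is dense in \<open>W\<close>; an open set that
    misses it cannot meet \<open>W\<close>.\<close>
  have tail: "A \<inter> W = {}"
    if A: "A \<in> L" "A \<in> \<tau>" and E: "E \<in> M" "thread E W" "v \<in> E" "v \<in> U" "v \<notin> A" for A E W v
  proof (rule ccontr)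
    assume ne: "A \<inter> W \<noteq> {}"
    have W: "dense_in (E - below v) W" "W \<in> \<tau>" using E by (auto simp: thread_def)
    have "A \<inter> W \<inter> (E - below v) \<noteq> {}"
      by (rule dense_inD[OF W(1) open_Int[OF A(2) W(2)] ne Int_lower2])
    then obtain y where y: "y \<in> A" "y \<in> E" "y \<notin> below v" by blast
    then have "(v, y) \<in> r" using order_total[of v y] order_refl by (auto simp: below_def)
    then have "v \<in> A" using initial[OF A(1) E(1)] E(3,4) y(1,2) by blast
    with E(5) show False ..
  qed
  have "complement U L"
    unfolding complement_def
  proof (intro conjI allI ballI impI)
    show "L \<subseteq> Pow U" "U \<in> L" by (auto simp: L_def)
    show "\<Union>F \<in> L" if "F \<subseteq> L" for F
      using that unfolding L_def by blast
    show "A \<inter> B \<in> L" if AB: "A \<in> L" "B \<in> L" for A B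
    proof -
      have "A \<inter> B \<subseteq> U" using AB by (auto simp: L_def)
      moreover have "x \<in> A \<inter> B"
        if "E \<in> M" "x \<in> E \<inter> U" "y \<in> E \<inter> (A \<inter> B)" "(x, y) \<in> r" for E x y
        using initial[OF AB(1) that(1,2) _ that(4)] initial[OF AB(2) that(1,2) _ that(4)] that(3)
        by simp
      ultimately show ?thesis unfolding L_def by blast
    qed
  next
    fix v assume v: "v \<in> U"
    then obtain E where E: "E \<in> M" "v \<in> E" using cover by blast
    then obtain W where "thread E W" using M by blast
    then obtain B where B: "B \<in> \<tau>" "v \<in> B" "B \<inter> E \<inter> below v = {}"
      using E(2) unfolding thread_def by metis
    \<comment> \<open>The least member of \<open>L\<close> containing \<open>v\<close>: the other
      threads are disjoint from \<open>E\<close> and impose nothing.\<close>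
    have "{x \<in> E \<inter> U. (x, v) \<in> r} \<in> L"
      unfolding L_def
    proof (intro CollectI conjI ballI impI)
      fix E' x y
      assume E': "E' \<in> M" and x: "x \<in> E' \<inter> U" and xy: "(x, y) \<in> r"
        and y: "y \<in> E' \<inter> {x \<in> E \<inter> U. (x, v) \<in> r}"
      have "\<not> disjnt E' E" using y by (auto simp: disjnt_def)
      then have "E' = E" using pairwiseD[OF disj E' E(1)] by blast
      with x show "x \<in> E \<inter> U" by simp
      show "(x, v) \<in> r" using order_trans[OF xy] y by simp
    qed blast
    moreover have "{x \<in> E \<inter> U. (x, v) \<in> r} \<inter> B = {v}"
      using B v E(2) order_refl by (auto simp: below_def)
    ultimately show "\<exists>A\<in>L. \<exists>B\<in>\<tau>. A \<inter> B = {v}" using B(1) by blast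
  next
    fix A assume A: "A \<in> L" "A \<in> \<tau>"
    show "A = {} \<or> A = U"
    proof (rule disjCI)
      assume "A \<noteq> U"
      then obtain v where v: "v \<in> U" "v \<notin> A" using A by (auto simp: L_def)
      then obtain E where E: "E \<in> M" "v \<in> E" using cover by blast
      then obtain W where W: "thread E W" using M by blast
      \<comment> \<open>The omission is carried from \<open>E\<close> to \<open>E0\<close>:
        \<open>A\<close> misses \<open>W\<close>, while \<open>E0\<close> meets the open set
        \<open>W \<inter> U\<close>, so \<open>A\<close> omits a point of \<open>E0\<close> and thus
        misses \<open>W0 \<supseteq> U\<close>.\<close>
      have AW: "A \<inter> W = {}" using tail[of A E W v] A E W v by blast
      have vW: "v \<in> W" "W \<in> \<tau>" using W E(2) by (auto simp: thread_def)
      obtain e where "dense_in (E0 - below e) W0"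
        using E0(2) unfolding thread_def by blast
      then have "W \<inter> U \<inter> (E0 - below e) \<noteq> {}"
        by (rule dense_inD) (use open_Int[OF vW(2) U(1)] vW(1) v(1) U(3) in auto)
      then obtain w where "w \<in> W" "w \<in> U" "w \<in> E0" by blast
      with AW have "A \<inter> W0 = {}" using tail[of A E0 W0 w] A E0 by blast
      with A U(3) show "A = {}" by (auto simp: L_def)
    qed
  qed
  moreover have "U \<subseteq> O1" using U(3) E0(3) by blast
  ultimately show thesis using U(1,2) that by metis
qed

section \<open>Gluing complements over a dense union\<close>

theorem complement_exists: "\<exists>L. complement Q L"
proof -
  obtain M where M: "M \<subseteq> {U \<in> \<tau>. U \<noteq> {} \<and> (\<exists>L. complement U L)}" and disj: "pairwise disjnt M"
    and max: "\<forall>X\<in>{U \<in> \<tau>. U \<noteq> {} \<and> (\<exists>L. complement U L)}. (\<forall>Y\<in>M. disjnt X Y) \<longrightarrow> X \<in> M"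
    by (rule maximal_disjoint_subfamily)
  have disj': "U = U'" if "U \<in> M" "U' \<in> M" "v \<in> U" "v \<in> U'" for U U' v
    using that disj unfolding pairwise_def disjnt_def by blast
  \<comment> \<open>A non-empty such \<open>A\<close> would contain a complemented open set, which
    maximality puts into \<open>M\<close>.\<close>
  have dense: "A = {}" if A: "A \<in> \<tau>" "A \<inter> \<Union>M = {}" for A
  proof (rule ccontr)
    assume "A \<noteq> {}"
    then obtain U where U: "U \<in> \<tau>" "U \<noteq> {}" "U \<subseteq> A" "\<exists>L. complement U L"
      using complemented_open_subset A(1) by metis
    then have "U \<in> M" using A(2) by (intro max[rule_format]) (auto simp: disjnt_def)
    with U(2,3) A(2) show False by blast
  qed
  have "\<forall>U\<in>M. \<exists>L. complement U L" using M by blast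
  then obtain l where l: "\<And>U. U \<in> M \<Longrightarrow> complement U (l U)" by metis
  have "\<forall>U\<in>M. \<exists>x. x \<in> U" using M by blast
  then obtain p where p: "\<And>U. U \<in> M \<Longrightarrow> p U \<in> U" by metis
  \<comment> \<open>The clause on \<open>p\<close> excludes unions of only some of the sets in
    \<open>M\<close>; the clause on \<open>Q - \<Union>M\<close> excludes \<open>\<Union>M\<close>
    itself when it is not all of \<open>Q\<close>.\<close>
  define L where "L = {A. A \<subseteq> Q \<and> (A \<inter> \<Union>M \<noteq> {} \<longrightarrow> Q - \<Union>M \<subseteq> A) \<and>
    (\<forall>U\<in>M. A \<inter> U \<in> l U) \<and> (\<forall>U\<in>M. p U \<in> A \<longrightarrow> p ` M \<subseteq> A)}"
  have outside: "Q - \<Union>M \<subseteq> A" if "A \<in> L" "A \<inter> \<Union>M \<noteq> {}" for A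
    using that by (simp add: L_def)
  have points: "p ` M \<subseteq> A" if "A \<in> L" "U \<in> M" "p U \<in> A" for A U
    using that unfolding L_def by blast
  have MQ: "\<Union>M \<subseteq> Q" using M open_subset by blast
  have "complement Q L"
    unfolding complement_def
  proof (intro conjI allI ballI impI)
    show "L \<subseteq> Pow Q" by (auto simp: L_def)
    have "Q \<inter> U \<in> l U" if "U \<in> M" for U
    proof -
      have "Q \<inter> U = U" using MQ that by blast
      then show ?thesis using complementD(2)[OF l[OF that]] by simp
    qed
    then show "Q \<in> L" using p MQ by (auto simp: L_def)
  next
    fix F assume F: "F \<subseteq> L"
    have "\<Union>F \<inter> U \<in> l U" if "U \<in> M" for U
    proof -
      have "(\<lambda>A. A \<inter> U) ` F \<subseteq> l U" using F that by (auto simp: L_def)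
      then have "\<Union>((\<lambda>A. A \<inter> U) ` F) \<in> l U" by (rule complementD(4)[OF l[OF that]])
      then show ?thesis by simp
    qed
    moreover have "\<Union>F \<subseteq> Q" "\<Union>F \<inter> \<Union>M \<noteq> {} \<longrightarrow> Q - \<Union>M \<subseteq> \<Union>F"
      "\<forall>U\<in>M. p U \<in> \<Union>F \<longrightarrow> p ` M \<subseteq> \<Union>F"
      using F unfolding L_def by blast+
    ultimately show "\<Union>F \<in> L" by (simp add: L_def)
  next
    fix A B assume AB: "A \<in> L" "B \<in> L"
    have "A \<inter> B \<inter> U \<in> l U" if "U \<in> M" for U
    proof -
      have "(A \<inter> U) \<inter> (B \<inter> U) \<in> l U"
        by (rule complementD(5)[OF l[OF that]]) (use AB that in \<open>simp_all add: L_def\<close>)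
      moreover have "(A \<inter> U) \<inter> (B \<inter> U) = A \<inter> B \<inter> U" by blast
      ultimately show ?thesis by simp
    qed
    moreover have "A \<inter> B \<subseteq> Q"
      using AB(1) by (auto simp: L_def)
    moreover have "A \<inter> B \<inter> \<Union>M \<noteq> {} \<longrightarrow> Q - \<Union>M \<subseteq> A \<inter> B"
      using outside[OF AB(1)] outside[OF AB(2)] by blast
    moreover have "\<forall>U\<in>M. p U \<in> A \<inter> B \<longrightarrow> p ` M \<subseteq> A \<inter> B"
      using points[OF AB(1)] points[OF AB(2)] by blast
    ultimately show "A \<inter> B \<in> L" by (simp add: L_def)
  next
    fix v assume v: "v \<in> Q"
    show "\<exists>A\<in>L. \<exists>B\<in>\<tau>. A \<inter> B = {v}"
    proof (cases "v \<in> \<Union>M")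
      case False
      then have "{v} \<inter> U = {}" "p U \<noteq> v" if "U \<in> M" for U using that p by blast+
      then have "{v} \<in> L" using v False complementD(3)[OF l] by (auto simp: L_def)
      with v open_space show ?thesis by blast
    next
      case True
      then obtain U where U: "U \<in> M" "v \<in> U" by blast
      then obtain A B where A: "A \<in> l U" and B: "B \<in> \<tau>" "A \<inter> B = {v}"
        using complementD(6)[OF l[OF U(1)] U(2)] by blast
      have AU: "A \<subseteq> U" using complementD(1)[OF l[OF U(1)] A] .
      \<comment> \<open>If \<open>A\<close> contains the chosen point of \<open>U\<close>, it must be enlarged by the other chosen points.\<close>
      define C where "C = A \<union> (Q - \<Union>M) \<union> (if p U \<in> A then \<Union>(M - {U}) else {})"
      have CU: "C \<inter> U = A" using AU U(1) disj' by (auto simp: C_def)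
      have CU': "C \<inter> U' = (if p U \<in> A then U' else {})" if "U' \<in> M" "U' \<noteq> U" for U'
        using that AU U(1) disj' by (auto simp: C_def)
      have "C \<inter> U' \<in> l U'" if "U' \<in> M" for U'
        using CU CU'[OF that] A complementD(2,3)[OF l[OF that]] by (cases "U' = U") auto
      moreover have "p ` M \<subseteq> C" if "U' \<in> M" "p U' \<in> C" for U'
      proof -
        have "p U \<in> A"
          using CU CU'[OF that(1)] p[OF that(1)] that(2) by (cases "U' = U") (auto split: if_splits)
        then show ?thesis using p by (auto simp: C_def)
      qed
      moreover have "C \<subseteq> Q" "Q - \<Union>M \<subseteq> C"
        using AU U(1) MQ by (auto simp: C_def split: if_splits)
      ultimately have "C \<in> L" unfolding L_def by blast
      moreover have "C \<inter> (U \<inter> B) = {v}" using CU B(2) by blast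
      moreover have "U \<inter> B \<in> \<tau>" using open_Int B(1) U(1) M by blast
      ultimately show ?thesis by blast
    qed
  next
    fix A assume A: "A \<in> L" "A \<in> \<tau>"
    show "A = {} \<or> A = Q"
    proof (cases "A = {}")
      case False
      then obtain U where U: "U \<in> M" "A \<inter> U \<noteq> {}" using dense A by blast
      \<comment> \<open>Each trace is empty or full. The one on \<open>U\<close> is full and
        contains \<open>p U\<close>, so \<open>A\<close> contains all chosen points and every trace
        is full.\<close>
      have all_or_none: "A \<inter> U' = {} \<or> A \<inter> U' = U'" if "U' \<in> M" for U'
      proof (rule complementD(7)[OF l[OF that]])
        show "A \<inter> U' \<in> l U'" using A(1) that by (simp add: L_def)
        show "A \<inter> U' \<in> \<tau>" using A(2) M that by (blast intro: open_Int)
      qed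
      have "p U \<in> A" using all_or_none[OF U(1)] U p by blast
      then have pA: "p ` M \<subseteq> A" by (rule points[OF A(1) U(1)])
      have "U' \<subseteq> A" if "U' \<in> M" for U'
        using all_or_none[OF that] p[OF that] pA that by blast
      then have "\<Union>M \<subseteq> A" by (rule Union_least)
      moreover have "Q - \<Union>M \<subseteq> A" using outside[OF A(1)] U by blast
      ultimately show ?thesis using open_subset[OF A(2)] by blast
    qed simp
  qed
  then show ?thesis ..
qed

end

section \<open>Application to knowledge spaces\<close>

lemma Int_finite_Inters:
  assumes "finite F \<and> F \<noteq> {} \<and> F \<subseteq> K \<and> x \<in> \<Inter>F \<and> \<Inter>F \<subseteq> A"
    and "finite G \<and> G \<noteq> {} \<and> G \<subseteq> K \<and> x \<in> \<Inter>G \<and> \<Inter>G \<subseteq> B"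
  shows "finite (F \<union> G) \<and> F \<union> G \<noteq> {} \<and> F \<union> G \<subseteq> K \<and> x \<in> \<Inter>(F \<union> G) \<and> \<Inter>(F \<union> G) \<subseteq> A \<inter> B"
  using assms by (auto simp: Inter_Un_distrib)

theorem theorem2p1:
  fixes Q :: "'a set" and K :: "'a set set"
  assumes "knowledge_space Q K"
    and "nontrivial_space Q K"
  shows "complementary Q K"
proof -
  have K: "Q \<noteq> {}" "K \<subseteq> Pow Q" "{} \<in> K" "Q \<in> K"
    using assms(1) by (auto simp: knowledge_space_def knowledge_structure_def)
  define nbh where "nbh x A F \<longleftrightarrow> finite F \<and> F \<noteq> {} \<and> F \<subseteq> K \<and> x \<in> \<Inter>F \<and> \<Inter>F \<subseteq> A" for x A F
  \<comment> \<open>The topology on \<open>Q\<close> with subbase \<open>K\<close>;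
    \<open>nbh x A F\<close> provides the basic neighbourhood \<open>\<Inter>F\<close> of
    \<open>x\<close> inside \<open>A\<close>.\<close>
  define \<tau> where "\<tau> = {A. A \<subseteq> Q \<and> (\<forall>x\<in>A. \<exists>F. nbh x A F)}"
  obtain r :: "'a rel" where r: "well_order_on UNIV r" using well_order_on by blast
  interpret well_ordered_base Q \<tau> r
  proof
    show "A \<subseteq> Q" if "A \<in> \<tau>" for A using that by (simp add: \<tau>_def)
    show "A \<inter> B \<in> \<tau>" if AB: "A \<in> \<tau>" "B \<in> \<tau>" for A B
    proof -
      have "\<exists>F. nbh x (A \<inter> B) F" if x: "x \<in> A \<inter> B" for x
      proof -
        obtain F G where "nbh x A F" "nbh x B G" using AB x unfolding \<tau>_def by blast
        then have "nbh x (A \<inter> B) (F \<union> G)" unfolding nbh_def by (rule Int_finite_Inters)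
        then show ?thesis ..
      qed
      then show ?thesis using AB by (auto simp: \<tau>_def)
    qed
    have "nbh x Q {Q}" if "x \<in> Q" for x using K that by (auto simp: nbh_def)
    then show "Q \<in> \<tau>" by (auto simp: \<tau>_def)
  qed (rule r)
  have K\<tau>: "K \<subseteq> \<tau>"
  proof
    fix A assume A: "A \<in> K"
    then have "nbh x A {A}" if "x \<in> A" for x using that by (simp add: nbh_def)
    then show "A \<in> \<tau>" using A K(2) by (auto simp: \<tau>_def)
  qed
  obtain L where "complement Q L" using complement_exists ..
  note L = complementD[OF this]
  have KL: "K \<inter> L = {{}, Q}" using K L(2,3,7) K\<tau> by blast
  have "knowledge_space Q L"
    using K(1) L(1-4) by (auto simp: knowledge_space_def knowledge_structure_def)
  \<comment> \<open>Otherwise closure under finite intersections and unions would put every subset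
    of \<open>Q\<close> into \<open>L\<close>, and \<open>K = K \<inter> L\<close> would be
    trivial.\<close>
  moreover have "\<not> discrete_space Q L"
  proof
    assume disc: "discrete_space Q L"
    have Inter: "\<Inter>F \<in> L" if "finite F" "F \<noteq> {}" "F \<subseteq> L" for F
      using that by (induction rule: finite_ne_induct) (auto intro: L(5))
    have single: "{q} \<in> L" if q: "q \<in> Q" for q
    proof -
      obtain F where "finite F" "F \<noteq> {}" "F \<subseteq> L" "{q} = \<Inter>F"
        using disc q unfolding discrete_space_def by metis
      then show ?thesis using Inter by simp
    qed
    have "A \<in> L" if "A \<subseteq> Q" for A
      using L(4)[of "(\<lambda>q. {q}) ` A"] single that by auto
    then have "K = {{}, Q}" using KL K(2) by blast
    with assms(2) show False by (simp add: nontrivial_space_def)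
  qed
  moreover have "\<exists>F G. finite F \<and> F \<noteq> {} \<and> F \<subseteq> K \<and> finite G \<and> G \<noteq> {} \<and> G \<subseteq> L \<and>
      \<Inter>F \<inter> \<Inter>G = {q}" if q: "q \<in> Q" for q
  proof -
    obtain A B where A: "A \<in> L" and B: "B \<in> \<tau>" "A \<inter> B = {q}" using L(6)[OF q] by blast
    \<comment> \<open>\<open>\<Inter>F\<close> can replace \<open>B\<close>, since it contains
      \<open>q\<close> and lies in \<open>B\<close>.\<close>
    then obtain F where "nbh q B F" unfolding \<tau>_def by blast
    then have "finite F" "F \<noteq> {}" "F \<subseteq> K" "\<Inter>F \<inter> \<Inter>{A} = {q}"
      using B(2) by (auto simp: nbh_def)
    then show ?thesis using A by (intro exI[of _ F] exI[of _ "{A}"]) auto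
  qed
  ultimately show ?thesis using KL unfolding complementary_def by blast
qed

end
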